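(* Consider the delay-coupled Stuart–Landau oscillators $$\dot z_1=(\alpha+i\beta)z_1+(\gamma+i\delta)|z_1|^2z_1+\varepsilon e^{i\rho}(z_2(t-\tau)-z_1),\qquad \dot z_2=(\alpha+i\beta)z_2+(\gamma+i\delta)|z_2|^2z_2+\varepsilon e^{i\rho}(z_1(t-\tau)-z_2),$$ whose uncoupled oscillators have periodic orbits $\Gamma_j(t)=Re^{i\Omega t}$, $R=\sqrt{-\alpha/\gamma}$, $\Omega=\beta-\alpha\delta/\gamma$. The first-order phase reduced dynamics $\dot\phi=f^{(0)}(\phi)+\varepsilon f^{(1)}(\phi)$ (defined in the context) gives, for $\psi:=\phi_1-\phi_2$, $$\dot\psi=-2\varepsilon\Big[\cos(\rho-\Omega\tau)+\frac\delta\gamma\sin(\rho-\Omega\tau)\Big]\sin(\psi).$$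
   Context: Parameters: $\alpha,\beta,\gamma,\delta\in\mathbb R$ with $\alpha\gamma<0$ and $\Omega\ne0$, $\varepsilon\ge0$ small, $\rho\in[0,2\pi]$, $\tau>0$; $\mathbb C$ is identified with $\mathbb R^2$ and $\mathbb T^2=(\mathbb R/2\pi\mathbb Z)^2$. Phase reduction. Let $F(z)=\big((\alpha+i\beta)z_j+(\gamma+i\delta)|z_j|^2z_j\big)_{j=1,2}$ and, for $Z\in C([-\tau,0],\mathbb C^2)$, $G(Z)=\big(e^{i\rho}[Z_2(-\tau)-Z_1(0)],\,e^{i\rho}[Z_1(-\tau)-Z_2(0)]\big)$. Put $$f^{(0)}\equiv\omega:=(\Omega,\Omega),\quad e^{(0)}(\phi)=(Re^{i\phi_1},Re^{i\phi_2}),\quad E^{(0)}(\phi,s)=(Re^{i(\phi_1+\Omega s)},Re^{i(\phi_2+\Omega s)}).$$ Let $T(\phi)=\partial_\phi e^{(0)}(\phi):\mathbb R^2\to\mathbb C^2$, i.e. $T(\phi)u=(iRe^{i\phi_1}u_1,iRe^{i\phi_2}u_2)$, let $N(\phi):\mathbb R^2\to\mathbb C^2$, $N(\phi)u=((\gamma+i\delta)e^{i\phi_1}u_1,(\gamma+i\delta)e^{i\phi_2}u_2)$, and let $\pi(\phi)$ be the real-linear projection of $\mathbb C^2$ onto $\operatorname{im}T(\phi)$ along $\operatorname{im}N(\phi)$. With $\eta^{(1)}(\phi)=G(E^{(0)}(\phi,\cdot))$ and $\partial_\omega:=\partial_\phi\cdot\omega$, the functions $g^{(1)},f^{(1)}:\mathbb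 T^2\to\mathbb R^2$ are the solution of $$T(\phi)[\partial_\omega g^{(1)}(\phi)+f^{(1)}(\phi)]=\pi(\phi)\eta^{(1)}(\phi)$$ for which $f^{(1)}$ is in normal form, i.e. the Fourier coefficients $\hat f^{(1)}_{\mathbf k}$ vanish whenever $\langle\mathbf k,\omega\rangle=\Omega(k_1+k_2)\ne0$, and $\hat g^{(1)}_{\mathbf k}=0$ whenever $\langle\mathbf k,\omega\rangle=0$. *)

theory Defs
  imports "HOL-Analysis.Analysis"
begin

text \<open>
  Indices range over the two-element type \<open>2\<close>; the other oscillator of \<open>j\<close> is \<open>j + 1\<close>
  (addition modulo two).  Functions on the torus are \<open>2\<pi>\<close>-periodic functions on \<open>real^2\<close>, and
  \<open>cis x\<close> is \<open>e\<^sup>i\<^sup>x\<close>.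
\<close>

definition SL_radius :: "real \<Rightarrow> real \<Rightarrow> real" where
  "SL_radius \<alpha> \<gamma> = sqrt (- \<alpha> / \<gamma>)"

definition SL_freq :: "real \<Rightarrow> real \<Rightarrow> real \<Rightarrow> real \<Rightarrow> real" where
  "SL_freq \<alpha> \<beta> \<gamma> \<delta> = \<beta> - \<alpha> * \<delta> / \<gamma>"

definition SL_field :: "real \<Rightarrow> real \<Rightarrow> real \<Rightarrow> real \<Rightarrow> complex^2 \<Rightarrow> complex^2" where
  "SL_field \<alpha> \<beta> \<gamma> \<delta> z =
     (\<chi> j. Complex \<alpha> \<beta> * z $ j + Complex \<gamma> \<delta> * (of_real (cmod (z $ j)))\<^sup>2 * z $ j)"

text \<open>The argument \<open>Z\<close> is a history segment; only its values on \<open>{-\<tau>..0}\<close> are relevant.\<close>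

definition SL_coupling :: "real \<Rightarrow> real \<Rightarrow> (real \<Rightarrow> complex^2) \<Rightarrow> complex^2" where
  "SL_coupling \<rho> \<tau> Z = (\<chi> j. cis \<rho> * (Z (- \<tau>) $ (j + 1) - Z 0 $ j))"

definition delay_SL_solution ::
    "real \<Rightarrow> real \<Rightarrow> real \<Rightarrow> real \<Rightarrow> real \<Rightarrow> real \<Rightarrow> real \<Rightarrow> (real \<Rightarrow> complex^2) \<Rightarrow> bool" where
  "delay_SL_solution \<alpha> \<beta> \<gamma> \<delta> \<rho> \<tau> \<epsilon> z \<longleftrightarrow>
     (\<forall>t. (z has_vector_derivative
             SL_field \<alpha> \<beta> \<gamma> \<delta> (z t) + \<epsilon> *\<^sub>R SL_coupling \<rho> \<tau> (\<lambda>s. z (t + s))) (at t))"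

definition SL_orbit :: "real \<Rightarrow> real \<Rightarrow> real \<Rightarrow> real \<Rightarrow> real \<Rightarrow> complex" where
  "SL_orbit \<alpha> \<beta> \<gamma> \<delta> t = of_real (SL_radius \<alpha> \<gamma>) * cis (SL_freq \<alpha> \<beta> \<gamma> \<delta> * t)"

definition nonconstant_periodic :: "(real \<Rightarrow> 'a) \<Rightarrow> bool" where
  "nonconstant_periodic x \<longleftrightarrow> (\<exists>P>0. \<forall>t. x (t + P) = x t) \<and> (\<exists>s t. x s \<noteq> x t)"

definition freq_vec :: "real \<Rightarrow> real \<Rightarrow> real \<Rightarrow> real \<Rightarrow> real^2" where
  "freq_vec \<alpha> \<beta> \<gamma> \<delta> = (\<chi> j. SL_freq \<alpha> \<beta> \<gamma> \<delta>)"

definition f0 :: "real \<Rightarrow> real \<Rightarrow> real \<Rightarrow> real \<Rightarrow> real^2 \<Rightarrow> real^2" where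
  "f0 \<alpha> \<beta> \<gamma> \<delta> \<phi> = freq_vec \<alpha> \<beta> \<gamma> \<delta>"

definition e0 :: "real \<Rightarrow> real \<Rightarrow> real^2 \<Rightarrow> complex^2" where
  "e0 \<alpha> \<gamma> \<phi> = (\<chi> j. of_real (SL_radius \<alpha> \<gamma>) * cis (\<phi> $ j))"

definition E0 :: "real \<Rightarrow> real \<Rightarrow> real \<Rightarrow> real \<Rightarrow> real^2 \<Rightarrow> real \<Rightarrow> complex^2" where
  "E0 \<alpha> \<beta> \<gamma> \<delta> \<phi> s =
     (\<chi> j. of_real (SL_radius \<alpha> \<gamma>) * cis (\<phi> $ j + SL_freq \<alpha> \<beta> \<gamma> \<delta> * s))"

definition tangent_map :: "real \<Rightarrow> real \<Rightarrow> real^2 \<Rightarrow> real^2 \<Rightarrow> complex^2" where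
  "tangent_map \<alpha> \<gamma> \<phi> = frechet_derivative (e0 \<alpha> \<gamma>) (at \<phi>)"

definition normal_map :: "real \<Rightarrow> real \<Rightarrow> real^2 \<Rightarrow> real^2 \<Rightarrow> complex^2" where
  "normal_map \<gamma> \<delta> \<phi> u = (\<chi> j. Complex \<gamma> \<delta> * cis (\<phi> $ j) * of_real (u $ j))"

definition projection_along :: "'a::real_vector set \<Rightarrow> 'a set \<Rightarrow> 'a \<Rightarrow> 'a" where
  "projection_along U V =
     (THE P. linear P \<and> P \<circ> P = P \<and> range P = U \<and> {z. P z = 0} = V)"

definition tangent_proj :: "real \<Rightarrow> real \<Rightarrow> real \<Rightarrow> real^2 \<Rightarrow> complex^2 \<Rightarrow> complex^2" where
  "tangent_proj \<alpha> \<gamma> \<delta> \<phi> =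
     projection_along (range (tangent_map \<alpha> \<gamma> \<phi>)) (range (normal_map \<gamma> \<delta> \<phi>))"

definition eta1 ::
    "real \<Rightarrow> real \<Rightarrow> real \<Rightarrow> real \<Rightarrow> real \<Rightarrow> real \<Rightarrow> real^2 \<Rightarrow> complex^2" where
  "eta1 \<alpha> \<beta> \<gamma> \<delta> \<rho> \<tau> \<phi> = SL_coupling \<rho> \<tau> (E0 \<alpha> \<beta> \<gamma> \<delta> \<phi>)"

definition torus_periodic :: "(real^2 \<Rightarrow> 'a) \<Rightarrow> bool" where
  "torus_periodic h \<longleftrightarrow> (\<forall>\<phi> j. h (\<phi> + axis j (2 * pi)) = h \<phi>)"

definition pairing :: "int^2 \<Rightarrow> real^2 \<Rightarrow> real" where
  "pairing k v = (\<Sum>j\<in>UNIV. of_int (k $ j) * v $ j)"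

definition fourier_coeff :: "(real^2 \<Rightarrow> real^2) \<Rightarrow> int^2 \<Rightarrow> complex^2" where
  "fourier_coeff h k =
     (\<chi> j. integral (cbox 0 (vec (2 * pi))) (\<lambda>\<phi>. of_real (h \<phi> $ j) * cis (- pairing k \<phi>))
            / (2 * pi)\<^sup>2)"

text \<open>
  The pair \<open>(g, f)\<close> solves the first-order equation, with \<open>f\<close> in normal form and \<open>g\<close> without
  resonant Fourier modes.  Differentiability of \<open>g\<close> and continuity of \<open>f\<close> are the regularity
  needed for a pointwise reading of the equation that determines both functions.
\<close>

definition first_order_solution ::
    "real \<Rightarrow> real \<Rightarrow> real \<Rightarrow> real \<Rightarrow> real \<Rightarrow> real
      \<Rightarrow> (real^2 \<Rightarrow> real^2) \<Rightarrow> (real^2 \<Rightarrow> real^2) \<Rightarrow> bool" where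
  "first_order_solution \<alpha> \<beta> \<gamma> \<delta> \<rho> \<tau> g f \<longleftrightarrow>
     torus_periodic g \<and> torus_periodic f \<and> g differentiable_on UNIV \<and> continuous_on UNIV f \<and>
     (\<forall>\<phi>. tangent_map \<alpha> \<gamma> \<phi> (frechet_derivative g (at \<phi>) (freq_vec \<alpha> \<beta> \<gamma> \<delta>) + f \<phi>)
          = tangent_proj \<alpha> \<gamma> \<delta> \<phi> (eta1 \<alpha> \<beta> \<gamma> \<delta> \<rho> \<tau> \<phi>)) \<and>
     (\<forall>k. pairing k (freq_vec \<alpha> \<beta> \<gamma> \<delta>) \<noteq> 0 \<longrightarrow> fourier_coeff f k = 0) \<and>
     (\<forall>k. pairing k (freq_vec \<alpha> \<beta> \<gamma> \<delta>) = 0 \<longrightarrow> fourier_coeff g k = 0)"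

definition f1 ::
    "real \<Rightarrow> real \<Rightarrow> real \<Rightarrow> real \<Rightarrow> real \<Rightarrow> real \<Rightarrow> real^2 \<Rightarrow> real^2" where
  "f1 \<alpha> \<beta> \<gamma> \<delta> \<rho> \<tau> =
     snd (THE p. first_order_solution \<alpha> \<beta> \<gamma> \<delta> \<rho> \<tau> (fst p) (snd p))"

text \<open>The trajectory \<open>\<phi>\<close> is a lift to \<open>real^2\<close> of a trajectory on the torus.\<close>

definition phase_trajectory ::
    "real \<Rightarrow> real \<Rightarrow> real \<Rightarrow> real \<Rightarrow> real \<Rightarrow> real \<Rightarrow> real \<Rightarrow> real set \<Rightarrow> (real \<Rightarrow> real^2) \<Rightarrow> bool" where
  "phase_trajectory \<alpha> \<beta> \<gamma> \<delta> \<rho> \<tau> \<epsilon> I \<phi> \<longleftrightarrow>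
     (\<forall>t\<in>I. (\<phi> has_vector_derivative
        f0 \<alpha> \<beta> \<gamma> \<delta> (\<phi> t) + \<epsilon> *\<^sub>R f1 \<alpha> \<beta> \<gamma> \<delta> \<rho> \<tau> (\<phi> t)) (at t within I))"

end

theory Submission
  imports Defs
begin

text \<open>
  In the frame rotating with \<open>\<phi>\<^sub>j\<close> the projection of \<open>\<eta>\<^sup>(\<^sup>1\<^sup>)\<close> onto the tangent space is an elementary
  computation; its coordinate \<open>h\<close> depends on the phase difference only.  Hence \<open>h\<close> has resonant modes
  only, \<open>(0, h)\<close> solves the first-order equation, and the formula for \<open>\<psi>\<close> is \<open>h\<^sub>1 - h\<^sub>2\<close>.

  For uniqueness, a difference of two solutions satisfies \<open>\<partial>\<^sub>\<omega> g = - f\<close>.  Since \<open>f\<close> has resonant modes only,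
  it is constant along the diagonal flow, so \<open>g\<close> is affine along every flow line; the flow lines
  are closed, so \<open>f = 0\<close>.  Then \<open>g\<close> is constant along the flow too, hence has resonant modes only,
  and those vanish by the normalization.  That a continuous function on the torus is determined by its
  Fourier coefficients follows from the Stone-Weierstrass theorem on the image of the torus in \<open>complex^2\<close>.
\<close>

section \<open>Periodic functions on boxes\<close>

text \<open>Cut both boxes across the direction \<open>i\<close>: the slab by which the translated
  box sticks out is, one period lower, the slab that the translation vacated. Only one axis moves
  here; diagonal shifts are composed later.\<close>

lemma integral_cbox_translate_periodic:
  fixes h :: "'a::euclidean_space \<Rightarrow> 'b::banach"
  assumes cont: "continuous_on UNIV h" and i: "i \<in> Basis"
    and per: "\<And>x. h (x + p *\<^sub>R i) = h x"
    and len: "b \<bullet> i = a \<bullet> i + p" and t: "0 \<le> t" "t \<le> p"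
  shows "integral (cbox a b) (\<lambda>x. h (x + t *\<^sub>R i)) = integral (cbox a b) h"
proof -
  have int: "h integrable_on cbox u v" for u v
    by (intro integrable_continuous continuous_on_subset[OF cont]) auto
  have shift: "integral (cbox u v) (\<lambda>x. h (x + c)) = integral (cbox (u + c) (v + c)) h" for u v c
    using integral_shift_cbox[of "u + c" c "v + c" h] by simp
  have inner: "(y + s *\<^sub>R i) \<bullet> j = y \<bullet> j + (if j = i then s else 0)" if "j \<in> Basis" for y s j
    using i that by (simp add: inner_add_left inner_Basis)
  note mem = set_eq_iff mem_box inner
  \<comment> \<open>\<open>s1\<close> and \<open>s4\<close> give the piece common to both boxes; the
    leftover slabs in \<open>s2\<close> and \<open>s3\<close> differ by the translation
    \<open>p *\<^sub>R i\<close>.\<close>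
  have s1: "cbox (a + t *\<^sub>R i) (b + t *\<^sub>R i) \<inter> {x. x \<bullet> i \<le> b \<bullet> i} = cbox (a + t *\<^sub>R i) b"
    using i len t by (fastforce simp: mem split: if_splits)
  have s2: "cbox (a + t *\<^sub>R i) (b + t *\<^sub>R i) \<inter> {x. b \<bullet> i \<le> x \<bullet> i} = cbox (a + p *\<^sub>R i) (b + t *\<^sub>R i)"
    using i len t by (fastforce simp: mem split: if_splits)
  have s3: "cbox a b \<inter> {x. x \<bullet> i \<le> a \<bullet> i + t} = cbox a (b + (t - p) *\<^sub>R i)"
    using i len t by (fastforce simp: mem split: if_splits)
  have s4: "cbox a b \<inter> {x. a \<bullet> i + t \<le> x \<bullet> i} = cbox (a + t *\<^sub>R i) b"
    using i len t by (fastforce simp: mem split: if_splits)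
  have "integral (cbox a b) (\<lambda>x. h (x + t *\<^sub>R i)) = integral (cbox (a + t *\<^sub>R i) (b + t *\<^sub>R i)) h"
    by (rule shift)
  also have "\<dots> = integral (cbox (a + t *\<^sub>R i) b) h + integral (cbox (a + p *\<^sub>R i) (b + t *\<^sub>R i)) h"
    using integral_split[OF int i, of "a + t *\<^sub>R i" "b + t *\<^sub>R i" "b \<bullet> i"] by (simp only: s1 s2)
  also have "integral (cbox (a + p *\<^sub>R i) (b + t *\<^sub>R i)) h = integral (cbox a (b + (t - p) *\<^sub>R i)) h"
    using shift[of a "b + (t - p) *\<^sub>R i" "p *\<^sub>R i"] by (simp add: per algebra_simps)
  also have "integral (cbox (a + t *\<^sub>R i) b) h + integral (cbox a (b + (t - p) *\<^sub>R i)) h = integral (cbox a b) h"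
    using integral_split[OF int i, of a b "a \<bullet> i + t"] by (simp add: s3 s4)
  finally show ?thesis .
qed

section \<open>Uniqueness of Fourier coefficients on the torus\<close>

text \<open>Realizes the torus as a compact subset of a Euclidean space; polynomials in the real
  coordinates there are trigonometric polynomials in the angles.\<close>

definition torus_embed :: "real^2 \<Rightarrow> complex^2" where
  "torus_embed \<phi> = (\<chi> j. cis (\<phi> $ j))"

lemma continuous_on_torus_embed: "continuous_on S torus_embed"
  unfolding torus_embed_def by (intro continuous_intros)

lemma torus_periodic_axis_int:
  assumes "torus_periodic f"
  shows "f (\<phi> + axis j (2 * pi * of_int n)) = f \<phi>"
proof (induction n rule: int_induct[where k=0])
  case base
  then show ?case by (simp add: axis_def vec_eq_iff zero_vec_def[symmetric])
next
  case (step1 n)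
  have "\<phi> + axis j (2 * pi * of_int (n + 1)) = \<phi> + axis j (2 * pi * of_int n) + axis j (2 * pi)"
    by (simp add: vec_eq_iff axis_def algebra_simps)
  with step1 assms show ?case by (metis torus_periodic_def)
next
  case (step2 n)
  have "\<phi> + axis j (2 * pi * of_int n) = \<phi> + axis j (2 * pi * of_int (n - 1)) + axis j (2 * pi)"
    by (simp add: vec_eq_iff axis_def algebra_simps)
  with step2 assms show ?case by (metis torus_periodic_def)
qed

text \<open>Equal sines and cosines force each coordinate to differ by an integer number of full
  turns, so both points lie in one orbit of the period lattice.\<close>

lemma torus_embed_eq_imp:
  assumes per: "torus_periodic f" and eq: "torus_embed \<phi> = torus_embed \<phi>'"
  shows "f \<phi> = f \<phi>'"
proof -
  have "\<exists>n::int. \<phi> $ j = \<phi>' $ j + 2 * pi * n" for j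
    using eq sin_cos_eq_iff[of "\<phi> $ j" "\<phi>' $ j"]
    by (simp add: torus_embed_def vec_eq_iff complex_eq_iff)
  then obtain n where n: "\<And>j. \<phi> $ j = \<phi>' $ j + 2 * pi * of_int (n j)" by metis
  have "\<phi> = \<phi>' + axis 1 (2 * pi * of_int (n 1)) + axis 2 (2 * pi * of_int (n 2))"
    using n by (simp add: vec_eq_iff forall_2 axis_def)
  then show ?thesis by (metis torus_periodic_axis_int[OF per])
qed

lemma torus_embed_box:
  obtains \<phi>' where "\<phi>' \<in> cbox 0 (vec (2 * pi))" "torus_embed \<phi>' = torus_embed \<phi>"
proof -
  have "\<exists>t. 0 \<le> t \<and> t < 2 * pi \<and> cos x = cos t \<and> sin x = sin t" for x :: real
    using sincos_total_2pi[of "cos x" "sin x"] by (metis sin_cos_squared_add2)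
  then have "\<forall>j. \<exists>t. 0 \<le> t \<and> t < 2 * pi \<and> cos (\<phi> $ j) = cos t \<and> sin (\<phi> $ j) = sin t"
    by blast
  then obtain t where t: "\<And>j. 0 \<le> t j \<and> t j < 2 * pi \<and> cos (\<phi> $ j) = cos (t j) \<and> sin (\<phi> $ j) = sin (t j)"
    unfolding choice_iff by blast
  show ?thesis
    by (rule that[of "\<chi> j. t j"]) (use t in \<open>auto simp: mem_box_cart torus_embed_def vec_eq_iff complex_eq_iff less_imp_le\<close>)
qed

text \<open>A continuous map on a compact box is a quotient map onto its Hausdorff image, so a
  function that is constant on the fibres descends continuously.\<close>

lemma torus_periodic_lift:
  fixes f :: "real^2 \<Rightarrow> 'a::topological_space"
  assumes per: "torus_periodic f" and cont: "continuous_on UNIV f"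
  obtains F where "continuous_on (torus_embed ` cbox 0 (vec (2 * pi))) F" "\<And>\<phi>. F (torus_embed \<phi>) = f \<phi>"
proof -
  let ?B = "cbox (0::real^2) (vec (2 * pi))"
  \<comment> \<open>Any preimage serves: on the image, \<open>torus_embed_eq_imp\<close> makes the
    choice immaterial.\<close>
  define F where "F z = f (SOME \<phi>. torus_embed \<phi> = z)" for z
  have F: "F (torus_embed \<phi>) = f \<phi>" for \<phi>
  proof -
    have "torus_embed (SOME \<phi>'. torus_embed \<phi>' = torus_embed \<phi>) = torus_embed \<phi>"
      by (rule someI) (rule refl)
    then show ?thesis unfolding F_def by (rule torus_embed_eq_imp[OF per])
  qed
  have "continuous_on (torus_embed ` ?B) F"
    unfolding continuous_on_open_gen[of F "torus_embed ` ?B" UNIV, simplified]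
  proof (intro allI impI)
    fix U :: "'a set" assume "open U"
    have "?B \<inter> torus_embed -` (torus_embed ` ?B \<inter> F -` U) = ?B \<inter> f -` U"
      using F by (auto dest!: arg_cong[of _ _ F])
    moreover have "openin (top_of_set ?B) (?B \<inter> f -` U)"
      using \<open>open U\<close> by (intro continuous_openin_preimage_gen continuous_on_subset[OF cont]) auto
    ultimately show "openin (top_of_set (torus_embed ` ?B)) (torus_embed ` ?B \<inter> F -` U)"
      using Abstract_Topology_2.continuous_imp_quotient_map[OF continuous_on_torus_embed refl compact_cbox, of "torus_embed ` ?B \<inter> F -` U" 0 "vec (2 * pi)"]
      by auto
  qed
  with F show ?thesis using that by blast
qed

text \<open>Scalar and unnormalized version of \<open>fourier_coeff\<close>; only the vanishing of
  coefficients matters, so the factor \<open>(2 * pi)\<^sup>2\<close> is dropped.\<close>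

definition fourier_int :: "(real^2 \<Rightarrow> real) \<Rightarrow> int^2 \<Rightarrow> complex" where
  "fourier_int f k = integral (cbox 0 (vec (2 * pi))) (\<lambda>\<phi>. of_real (f \<phi>) * cis (- pairing k \<phi>))"

lemma fourier_coeff_nth: "fourier_coeff h k $ j = fourier_int (\<lambda>\<phi>. h \<phi> $ j) k / (2 * pi)\<^sup>2"
  by (simp add: fourier_coeff_def fourier_int_def)

lemma continuous_on_pairing [continuous_intros]:
  "continuous_on S g \<Longrightarrow> continuous_on S (\<lambda>x. pairing k (g x))"
  unfolding pairing_def by (intro continuous_intros)

lemma fourier_integrable:
  "continuous_on UNIV f \<Longrightarrow> (\<lambda>\<phi>. of_real (f \<phi>) * cis (- pairing k \<phi>)) integrable_on cbox a b"
  by (intro integrable_continuous continuous_intros) (auto intro: continuous_on_subset)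

lemma fourier_int_add:
  assumes "continuous_on UNIV f" "continuous_on UNIV g"
  shows "fourier_int (\<lambda>\<phi>. f \<phi> + g \<phi>) k = fourier_int f k + fourier_int g k"
  unfolding fourier_int_def
  by (simp add: distrib_right integral_add fourier_integrable assms)

lemma fourier_int_cmult: "fourier_int (\<lambda>\<phi>. f \<phi> * c) k = fourier_int f k * of_real c"
proof -
  have "(\<lambda>\<phi>. of_real (f \<phi> * c) * cis (- pairing k \<phi>)) =
        (\<lambda>\<phi>. (of_real (f \<phi>) * cis (- pairing k \<phi>)) * of_real c)" by (simp add: mult_ac)
  then show ?thesis unfolding fourier_int_def by (simp only: integral_mult_left)
qed

lemma fourier_int_diff:
  assumes "continuous_on UNIV f" "continuous_on UNIV g"
  shows "fourier_int (\<lambda>\<phi>. f \<phi> - g \<phi>) k = fourier_int f k - fourier_int g k"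
  unfolding fourier_int_def
  by (simp add: left_diff_distrib integral_diff fourier_integrable assms)

lemma pairing_axis: "pairing (axis j 1) \<phi> = \<phi> $ j"
  by (simp add: pairing_def axis_def of_bool_def if_distrib if_distribR cong: if_cong)

lemma pairing_add_left: "pairing (k + l) \<phi> = pairing k \<phi> + pairing l \<phi>"
  by (simp add: pairing_def sum.distrib algebra_simps)

lemma pairing_diff_left: "pairing (k - l) \<phi> = pairing k \<phi> - pairing l \<phi>"
  by (simp add: pairing_def sum_subtractf algebra_simps)

lemma pairing_add_right: "pairing k (\<phi> + \<psi>) = pairing k \<phi> + pairing k \<psi>"
  by (simp add: pairing_def sum.distrib algebra_simps)

text \<open>Euler's formula: the cosine is the mean of two characters, each of which shifts the mode
  by one in direction \<open>j\<close>. Hence a function without Fourier modes stays so under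
  multiplication by cosines, and likewise by sines.\<close>

lemma fourier_int_mult_cos:
  assumes "continuous_on UNIV f"
  shows "fourier_int (\<lambda>\<phi>. f \<phi> * cos (\<phi> $ j)) k =
         (fourier_int f (k + axis j 1) + fourier_int f (k - axis j 1)) / 2"
proof -
  have "(\<lambda>\<phi>. of_real (f \<phi> * cos (\<phi> $ j)) * cis (- pairing k \<phi>)) =
    (\<lambda>\<phi>. (of_real (f \<phi>) * cis (- pairing (k + axis j 1) \<phi>) + of_real (f \<phi>) * cis (- pairing (k - axis j 1) \<phi>)) / 2)"
    by (auto simp: fun_eq_iff complex_eq_iff pairing_add_left pairing_diff_left pairing_axis
        cos_add cos_diff sin_add sin_diff field_simps)
  then show ?thesis unfolding fourier_int_def
    by (simp add: integral_add[symmetric] fourier_integrable assms)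
qed

lemma fourier_int_mult_sin:
  assumes "continuous_on UNIV f"
  shows "fourier_int (\<lambda>\<phi>. f \<phi> * sin (\<phi> $ j)) k =
         (fourier_int f (k + axis j 1) - fourier_int f (k - axis j 1)) * (\<i> / 2)"
proof -
  have "(\<lambda>\<phi>. of_real (f \<phi> * sin (\<phi> $ j)) * cis (- pairing k \<phi>)) =
    (\<lambda>\<phi>. (of_real (f \<phi>) * cis (- pairing (k + axis j 1) \<phi>) - of_real (f \<phi>) * cis (- pairing (k - axis j 1) \<phi>)) * (\<i> / 2))"
    by (auto simp: fun_eq_iff complex_eq_iff pairing_add_left pairing_diff_left pairing_axis
        cos_add cos_diff sin_add sin_diff field_simps)
  then show ?thesis unfolding fourier_int_def
    by (simp add: integral_diff[symmetric] fourier_integrable assms del: times_divide_eq_right)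
qed

lemma continuous_on_polynomial_torus_embed:
  assumes "real_polynomial_function p"
  shows "continuous_on S (\<lambda>\<phi>. p (torus_embed \<phi>))"
proof -
  have "continuous_on UNIV p"
    using assms by (simp add: continuous_on_polymonial_function real_polynomial_function_eq)
  then show ?thesis by (rule continuous_on_compose2[OF _ continuous_on_torus_embed]) simp
qed

text \<open>Induction on the polynomial with \<open>f\<close> and \<open>k\<close> general: a factor
  of a product can then be absorbed into \<open>f\<close>.\<close>

lemma fourier_int_mult_polynomial_zero:
  fixes f :: "real^2 \<Rightarrow> real"
  assumes "real_polynomial_function p"
    and "continuous_on UNIV f" and "\<And>k. fourier_int f k = 0"
  shows "fourier_int (\<lambda>\<phi>. f \<phi> * p (torus_embed \<phi>)) k = 0"
  using assms
proof (induction arbitrary: f k rule: real_polynomial_function.induct)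
  case (linear h)
  interpret bounded_linear h by fact
  \<comment> \<open>Expansion in the real basis of \<open>complex^2\<close>, by which a real-linear
    functional of \<open>torus_embed \<phi>\<close> becomes a combination of the cosines and sines
    of the angles.\<close>
  have z: "z = (\<Sum>j\<in>UNIV. Re (z $ j) *\<^sub>R axis j 1 + Im (z $ j) *\<^sub>R axis j \<i>)" for z :: "complex^2"
    by (simp add: vec_eq_iff forall_2 sum_2 axis_def complex_eq_iff)
  have "h (torus_embed \<phi>) = (cos (\<phi> $ 1) * h (axis 1 1) + sin (\<phi> $ 1) * h (axis 1 \<i>)) +
      (cos (\<phi> $ 2) * h (axis 2 1) + sin (\<phi> $ 2) * h (axis 2 \<i>))" for \<phi>
    by (subst z) (simp add: sum_2 torus_embed_def add scaleR)
  then have "fourier_int (\<lambda>\<phi>. f \<phi> * h (torus_embed \<phi>)) k =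
     fourier_int (\<lambda>\<phi>. (f \<phi> * cos (\<phi> $ 1) * h (axis 1 1) + f \<phi> * sin (\<phi> $ 1) * h (axis 1 \<i>)) +
      (f \<phi> * cos (\<phi> $ 2) * h (axis 2 1) + f \<phi> * sin (\<phi> $ 2) * h (axis 2 \<i>))) k"
    by (simp add: algebra_simps)
  also have "\<dots> = 0"
    using linear.prems
    by (simp add: fourier_int_add fourier_int_cmult fourier_int_mult_cos fourier_int_mult_sin
        continuous_on_add continuous_on_mult continuous_on_sin continuous_on_cos continuous_on_component)
  finally show ?case .
next
  case (const c)
  then show ?case by (simp add: fourier_int_cmult)
next
  case (add p q)
  have "continuous_on UNIV (\<lambda>\<phi>. p (torus_embed \<phi>))" "continuous_on UNIV (\<lambda>\<phi>. q (torus_embed \<phi>))"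
    by (rule continuous_on_polynomial_torus_embed add.hyps)+
  with add show ?case by (simp add: distrib_left fourier_int_add continuous_on_mult)
next
  case (mult p q)
  \<comment> \<open>By the hypothesis for \<open>p\<close>, the function \<open>f * p\<close> again
    has no modes, so the hypothesis for \<open>q\<close> applies to it in place of
    \<open>f\<close>.\<close>
  have "continuous_on UNIV (\<lambda>\<phi>. f \<phi> * p (torus_embed \<phi>))"
    by (intro continuous_on_mult mult.prems continuous_on_polynomial_torus_embed mult.hyps)
  with mult show ?case by (simp add: mult.assoc[symmetric])
qed

text \<open>Such an \<open>f\<close> is orthogonal to every trigonometric polynomial
  \<open>p\<close>, so the integral of \<open>f * f\<close> equals that of
  \<open>f * (f - p)\<close>, which uniform approximation makes arbitrarily small.\<close>

lemma fourier_int_zero_imp_zero: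
  fixes f :: "real^2 \<Rightarrow> real"
  assumes per: "torus_periodic f" and cont: "continuous_on UNIV f" and zero: "\<And>k. fourier_int f k = 0"
  shows "f \<phi> = 0"
proof -
  let ?B = "cbox (0::real^2) (vec (2 * pi))"
  have cB: "continuous_on ?B f" by (rule continuous_on_subset[OF cont]) simp
  obtain F where F: "continuous_on (torus_embed ` ?B) F" "\<And>\<phi>. F (torus_embed \<phi>) = f \<phi>"
    using torus_periodic_lift[OF per cont] by blast
  have ff: "(\<lambda>\<phi>. f \<phi> * f \<phi>) integrable_on ?B"
    by (intro integrable_continuous continuous_intros cB)
  let ?C = "integral ?B (\<lambda>\<phi>. \<bar>f \<phi>\<bar>)"
  have bound: "integral ?B (\<lambda>\<phi>. f \<phi> * f \<phi>) \<le> e * ?C" if e: "e > 0" for e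
  proof -
    obtain p where p: "real_polynomial_function p" "\<And>z. z \<in> torus_embed ` ?B \<Longrightarrow> \<bar>F z - p z\<bar> < e"
      using Stone_Weierstrass_real_polynomial_function[OF _ F(1) e]
      by (metis compact_cbox compact_continuous_image continuous_on_torus_embed)
    have cp: "continuous_on UNIV (\<lambda>\<phi>. p (torus_embed \<phi>))"
      by (rule continuous_on_polynomial_torus_embed[OF p(1)])
    note cpB = continuous_on_subset[OF cp subset_UNIV]
    \<comment> \<open>The plain integral of \<open>f * p\<close> is its Fourier integral at mode
      zero.\<close>
    have "integral ?B (\<lambda>\<phi>. complex_of_real (f \<phi> * p (torus_embed \<phi>))) = 0"
      using fourier_int_mult_polynomial_zero[OF p(1) cont zero, of 0]
      by (simp add: fourier_int_def pairing_def)
    moreover have fp: "(\<lambda>\<phi>. f \<phi> * p (torus_embed \<phi>)) integrable_on ?B"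
      by (intro integrable_continuous continuous_intros cB cpB)
    ultimately have "integral ?B (\<lambda>\<phi>. f \<phi> * p (torus_embed \<phi>)) = 0"
      using integral_linear[OF fp bounded_linear_of_real[where 'a=complex]] by (simp add: comp_def)
    then have "integral ?B (\<lambda>\<phi>. f \<phi> * f \<phi>) = integral ?B (\<lambda>\<phi>. f \<phi> * f \<phi> - f \<phi> * p (torus_embed \<phi>))"
      using integral_diff[OF ff fp] by simp
    also have "\<dots> \<le> integral ?B (\<lambda>\<phi>. e * \<bar>f \<phi>\<bar>)"
    proof (rule integral_le)
      fix \<phi> assume "\<phi> \<in> ?B"
      then have "\<bar>f \<phi> - p (torus_embed \<phi>)\<bar> \<le> e" using p(2) F(2) by (metis imageI less_imp_le)
      then have "\<bar>f \<phi>\<bar> * \<bar>f \<phi> - p (torus_embed \<phi>)\<bar> \<le> \<bar>f \<phi>\<bar> * e" by (intro mult_left_mono) auto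
      then show "f \<phi> * f \<phi> - f \<phi> * p (torus_embed \<phi>) \<le> e * \<bar>f \<phi>\<bar>"
        by (simp add: abs_mult[symmetric] right_diff_distrib mult.commute)
    qed (auto intro!: integrable_continuous continuous_intros cB cpB)
    finally show ?thesis by simp
  qed
  have nonneg: "0 \<le> ?C" by (rule integral_nonneg) (auto intro!: integrable_continuous continuous_intros cB)
  have "integral ?B (\<lambda>\<phi>. f \<phi> * f \<phi>) \<le> 0"
  proof (rule field_le_epsilon)
    fix e :: real assume "e > 0"
    \<comment> \<open>The summand 1 keeps the denominator positive even if \<open>?C\<close> is
      zero.\<close>
    then have "integral ?B (\<lambda>\<phi>. f \<phi> * f \<phi>) \<le> e / (?C + 1) * ?C" using nonneg by (intro bound) simp
    also have "\<dots> \<le> 0 + e" using nonneg \<open>e > 0\<close> by (simp add: field_simps)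
    finally show "integral ?B (\<lambda>\<phi>. f \<phi> * f \<phi>) \<le> 0 + e" .
  qed
  moreover have "integral ?B (\<lambda>\<phi>. f \<phi> * f \<phi>) \<ge> 0"
    by (rule integral_nonneg) (auto intro!: integrable_continuous continuous_intros cB)
  \<comment> \<open>A continuous nonnegative function with integral zero vanishes on all of a box
    that has interior points.\<close>
  moreover have "box (0::real^2) (vec (2 * pi)) \<noteq> {}"
    by (simp add: interval_ne_empty_cart)
  ultimately have "\<forall>\<phi>\<in>?B. f \<phi> * f \<phi> = 0"
    by (subst integral_cbox_eq_0_iff[symmetric]) (auto intro!: continuous_intros cB)
  moreover obtain \<phi>' where "\<phi>' \<in> ?B" and \<phi>': "torus_embed \<phi>' = torus_embed \<phi>"
    by (rule torus_embed_box)
  ultimately have "f \<phi>' = 0" by simp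
  then show ?thesis using torus_embed_eq_imp[OF per \<phi>'] by simp
qed

section \<open>Transport along the diagonal flow\<close>

text \<open>Since \<open>k\<close> is integral, \<open>f\<close> times the character is periodic in
  each coordinate. Its integral therefore survives a shift along one axis and then along the other;
  the factor is what the shift does to the character.\<close>

lemma fourier_int_translate_diagonal:
  assumes per: "torus_periodic f" and cont: "continuous_on UNIV f" and t: "0 \<le> t" "t \<le> 2 * pi"
  shows "fourier_int (\<lambda>\<phi>. f (\<phi> + vec t)) k = cis (pairing k (vec t)) * fourier_int f k"
proof -
  let ?B = "cbox (0::real^2) (vec (2 * pi))"
  define H where "H \<phi> = of_real (f \<phi>) * cis (- pairing k \<phi>)" for \<phi>
  have H_cont: "continuous_on UNIV H"
    unfolding H_def by (intro continuous_intros cont)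
  have pair: "pairing k (axis j (2 * pi)) = 2 * pi * of_int (k $ j)" for j
    by (simp add: pairing_def axis_def if_distrib if_distribR mult.commute cong: if_cong)
  have H_per: "H (\<phi> + (2 * pi) *\<^sub>R axis j 1) = H \<phi>" for \<phi> j
  proof -
    have "(2 * pi) *\<^sub>R axis j 1 = axis j (2 * pi)" by (simp add: vec_eq_iff axis_def)
    moreover have "cis (- pairing k (\<phi> + axis j (2 * pi))) = cis (- pairing k \<phi>)"
    proof -
      have "cis (- pairing k (\<phi> + axis j (2 * pi))) = cis (- pairing k \<phi>) * cis (2 * pi * of_int (- k $ j))"
        by (simp add: pairing_add_right pair cis_mult)
      also have "cis (2 * pi * of_int (- k $ j)) = 1" by (rule cis_multiple_2pi) simp
      finally show ?thesis by simp
    qed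
    ultimately show ?thesis using per by (simp add: H_def torus_periodic_def)
  qed
  have shift: "integral ?B (\<lambda>\<phi>. h (\<phi> + t *\<^sub>R axis j 1)) = integral ?B h"
    if "continuous_on UNIV h" "\<And>\<phi>. h (\<phi> + (2 * pi) *\<^sub>R axis j 1) = h \<phi>" for h :: "real^2 \<Rightarrow> complex" and j
    using that t by (intro integral_cbox_translate_periodic[where p="2 * pi"]) (auto simp: axis_in_Basis_iff inner_axis)
  have "integral ?B (\<lambda>\<phi>. H (\<phi> + vec t)) = integral ?B (\<lambda>\<phi>. H (\<phi> + t *\<^sub>R axis 1 1 + t *\<^sub>R axis 2 1))"
    by (rule integral_cong) (auto intro!: arg_cong[of _ _ H] simp: vec_eq_iff forall_2 axis_def)
  also have "\<dots> = integral ?B (\<lambda>\<phi>. H (\<phi> + t *\<^sub>R axis 2 1))"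
  proof (rule shift[of "\<lambda>\<phi>. H (\<phi> + t *\<^sub>R axis 2 1)"])
    show "continuous_on UNIV (\<lambda>\<phi>. H (\<phi> + t *\<^sub>R axis 2 1))"
      by (rule continuous_on_compose2[OF H_cont]) (auto intro!: continuous_intros)
    show "H (\<phi> + (2 * pi) *\<^sub>R axis 1 1 + t *\<^sub>R axis 2 1) = H (\<phi> + t *\<^sub>R axis 2 1)" for \<phi>
      using H_per[of "\<phi> + t *\<^sub>R axis 2 1" 1] by (simp add: add_ac)
  qed
  also have "\<dots> = integral ?B H" by (rule shift[OF H_cont H_per])
  finally have "integral ?B (\<lambda>\<phi>. H (\<phi> + vec t)) = integral ?B H" .
  moreover have "of_real (f (\<phi> + vec t)) * cis (- pairing k \<phi>) = cis (pairing k (vec t)) * H (\<phi> + vec t)" for \<phi>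
    by (simp add: H_def pairing_add_right mult.left_commute cis_mult)
  ultimately show ?thesis
    unfolding fourier_int_def by (simp add: integral_mult_right H_def[symmetric])
qed

lemma pairing_vec: "pairing k (vec t) = t * of_int (k $ 1 + k $ 2)"
  by (simp add: pairing_def sum_2 algebra_simps)

lemma diagonal_invariant_fourier_int_zero:
  assumes per: "torus_periodic f" and cont: "continuous_on UNIV f"
    and inv: "\<And>t \<phi>. 0 \<le> t \<Longrightarrow> t \<le> 2 * pi \<Longrightarrow> f (\<phi> + vec t) = f \<phi>"
    and k: "k $ 1 + k $ 2 \<noteq> 0"
  shows "fourier_int f k = 0"
proof -
  define m where "m = k $ 1 + k $ 2"
  \<comment> \<open>Chosen so that \<open>t * m\<close> is half a turn up to sign, which makes the
    translation factor \<open>- 1\<close>. As \<open>m\<close> is a nonzero integer,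
    \<open>t\<close> stays within one period.\<close>
  define t where "t = pi / \<bar>of_int m\<bar>"
  have "1 \<le> \<bar>real_of_int m\<bar>" using k unfolding m_def[symmetric] by linarith
  then have t: "0 \<le> t" "t \<le> 2 * pi" by (auto simp: t_def divide_le_eq intro: order_trans[of _ "2 * pi * 1"])
  have "t * of_int m = pi \<or> t * of_int m = - pi"
    using k unfolding m_def[symmetric] t_def by (auto simp: abs_if)
  then have "cis (pairing k (vec t)) = - 1"
    unfolding pairing_vec m_def[symmetric] by (auto simp: complex_eq_iff)
  with fourier_int_translate_diagonal[OF per cont t, of k] have "fourier_int f k = - fourier_int f k"
    by (simp add: inv[OF t])
  then show ?thesis by (simp add: eq_neg_iff_add_eq_0)
qed

text \<open>Scalar core of the uniqueness proof, at unit speed along the diagonal. It is meant for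
  each component of the difference of two solutions, with \<open>f\<close> in the role of the
  derivative of \<open>g\<close> along the flow.\<close>

lemma diagonal_transport_zero:
  fixes f g :: "real^2 \<Rightarrow> real"
  assumes per: "torus_periodic f" "torus_periodic g"
    and cont: "continuous_on UNIV f" "continuous_on UNIV g"
    and der: "\<And>\<phi> t. ((\<lambda>s. g (\<phi> + vec s)) has_real_derivative f (\<phi> + vec t)) (at t)"
    and f: "\<And>k. k $ 1 + k $ 2 \<noteq> 0 \<Longrightarrow> fourier_int f k = 0"
    and g: "\<And>k. k $ 1 + k $ 2 = 0 \<Longrightarrow> fourier_int g k = 0"
  shows "f \<phi> = 0" "g \<phi> = 0"
proof -
  \<comment> \<open>Translation multiplies mode \<open>k\<close> by a factor that is 1 if
    \<open>k $ 1 + k $ 2 = 0\<close>; all other modes of \<open>f\<close> are zero. So the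
    difference has no modes at all.\<close>
  have f_inv: "f (\<phi> + vec t) = f \<phi>" if t: "0 \<le> t" "t \<le> 2 * pi" for \<phi> t
  proof -
    have c: "continuous_on UNIV (\<lambda>\<phi>. f (\<phi> + vec t))"
      by (rule continuous_on_compose2[OF cont(1)]) (auto intro!: continuous_intros)
    have "f (\<phi> + vec t) - f \<phi> = 0"
    proof (rule fourier_int_zero_imp_zero[where f="\<lambda>\<phi>. f (\<phi> + vec t) - f \<phi>"])
      have "f (\<phi> + axis j (2 * pi) + vec t) = f (\<phi> + vec t)" for \<phi> j
        using per(1) unfolding torus_periodic_def by (metis add.assoc add.commute)
      then show "torus_periodic (\<lambda>\<phi>. f (\<phi> + vec t) - f \<phi>)"
        using per(1) by (simp add: torus_periodic_def)
      show "continuous_on UNIV (\<lambda>\<phi>. f (\<phi> + vec t) - f \<phi>)"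
        by (intro continuous_intros c cont)
      show "fourier_int (\<lambda>\<phi>. f (\<phi> + vec t) - f \<phi>) k = 0" for k
        using f[of k]
        by (cases "k $ 1 + k $ 2 = 0")
          (simp_all add: fourier_int_diff c cont fourier_int_translate_diagonal[OF per(1) cont(1) t] pairing_vec flip: of_int_add)
    qed
    then show ?thesis by simp
  qed
  have growth: "g (\<phi> + vec t) = g \<phi> + t * f \<phi>" if t: "0 \<le> t" "t \<le> 2 * pi" for \<phi> t
  proof (cases "t = 0")
    case False
    \<comment> \<open>Subtracting the expected linear growth leaves derivative zero, because
      \<open>f\<close> is constant along the flow line.\<close>
    let ?u = "\<lambda>s. g (\<phi> + vec s) - s * f \<phi>"
    have d: "(?u has_real_derivative f (\<phi> + vec s) - f \<phi>) (at s)" for s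
      by (rule der derivative_eq_intros refl | simp)+
    have "?u t = ?u 0"
    proof (rule DERIV_isconst_end[where f="?u" and a=0 and b=t])
      show "continuous_on {0..t} ?u"
        by (intro continuous_at_imp_continuous_on ballI DERIV_isCont[OF d])
      show "(?u has_real_derivative 0) (at s)" if "0 < s" "s < t" for s
        using d[of s] f_inv[of s \<phi>] that t by simp
    qed (use False t in auto)
    then show ?thesis by (simp add: vec_0)
  qed (simp add: vec_0)
  have f0: "f \<phi> = 0" for \<phi>
  proof -
    \<comment> \<open>The flow line closes after time \<open>2 * pi\<close>, so the linear growth of
      \<open>g\<close> over that time must vanish.\<close>
    have "\<phi> + vec (2 * pi) = \<phi> + axis 1 (2 * pi) + axis 2 (2 * pi)"
      by (simp add: vec_eq_iff forall_2 axis_def)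
    then have "g (\<phi> + vec (2 * pi)) = g \<phi>" using per(2) by (metis torus_periodic_def)
    then show ?thesis using growth[of "2 * pi" \<phi>] by simp
  qed
  then show "f \<phi> = 0" .
  have "g (\<phi> + vec t) = g \<phi>" if "0 \<le> t" "t \<le> 2 * pi" for t \<phi>
    using growth[OF that] f0 by simp
  then have "fourier_int g k = 0" for k
    using g[of k] diagonal_invariant_fourier_int_zero[OF per(2) cont(2)] by blast
  then show "g \<phi> = 0" by (rule fourier_int_zero_imp_zero[OF per(2) cont(2)])
qed

section \<open>The first-order equation\<close>

text \<open>\<open>Q\<close> reads off coordinates along \<open>T\<close> and has kernel
  \<open>V\<close>. Any projection with the prescribed range and kernel fixes \<open>T (Q z)\<close>
  and kills \<open>z - T (Q z)\<close>, hence it is \<open>T \<circ> Q\<close>; this resolves the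
  definite description.\<close>

lemma projection_along_eqI:
  assumes "linear T" "linear Q" "\<And>u. Q (T u) = u" "{z. Q z = 0} = V"
  shows "projection_along (range T) V = T \<circ> Q"
  unfolding projection_along_def
proof (rule the_equality)
  have "range (T \<circ> Q) = range T"
    using surjI[of Q T, OF assms(3)] by (simp only: image_comp[symmetric])
  moreover have "T (Q z) = 0 \<longleftrightarrow> Q z = 0" for z
    by (metis assms(3) linear_0[OF assms(1)])
  ultimately show "linear (T \<circ> Q) \<and> (T \<circ> Q) \<circ> (T \<circ> Q) = T \<circ> Q \<and> range (T \<circ> Q) = range T
      \<and> {z. (T \<circ> Q) z = 0} = V"
    using assms by (auto intro: linear_compose simp: fun_eq_iff)
next
  fix P assume P: "linear P \<and> P \<circ> P = P \<and> range P = range T \<and> {z. P z = 0} = V"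
  show "P = T \<circ> Q"
  proof
    fix z
    have PT: "P (T u) = T u" for u
      using P by (metis comp_apply rangeE rangeI)
    have "Q (z - T (Q z)) = 0" by (simp add: linear_diff[OF assms(2)] assms(3))
    then have "P (z - T (Q z)) = 0" using P assms(4) by blast
    then show "P z = (T \<circ> Q) z" using P by (simp add: linear_diff PT)
  qed
qed

section \<open>The tangent map and the tangential coordinate\<close>

lemma SL_radius_pos: "\<alpha> * \<gamma> < 0 \<Longrightarrow> 0 < SL_radius \<alpha> \<gamma>"
  by (auto simp: SL_radius_def mult_less_0_iff divide_less_0_iff)

lemma SL_radius_sq: "\<alpha> * \<gamma> < 0 \<Longrightarrow> (SL_radius \<alpha> \<gamma>)\<^sup>2 = - \<alpha> / \<gamma>"
  using SL_radius_pos[of \<alpha> \<gamma>] by (simp add: SL_radius_def)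

text \<open>A vector is the finite sum of its axis embeddings, which are bounded linear.\<close>

lemma has_derivative_vec_lambda:
  fixes f :: "'a::real_normed_vector \<Rightarrow> 'n::finite \<Rightarrow> 'b::euclidean_space"
  assumes "\<And>j. ((\<lambda>x. f x j) has_derivative (\<lambda>h. f' h j)) F"
  shows "((\<lambda>x. \<chi> j. f x j) has_derivative (\<lambda>h. \<chi> j. f' h j)) F"
proof -
  have ax: "(\<chi> j. v j) = (\<Sum>j\<in>UNIV. axis j (v j))" for v :: "'n \<Rightarrow> 'b"
    by (simp add: vec_eq_iff axis_def if_distrib cong: if_cong)
  have lin: "bounded_linear (axis j :: 'b \<Rightarrow> 'b^'n)" for j
    by (intro linear_conv_bounded_linear[THEN iffD1] linearI) (auto simp: vec_eq_iff axis_def)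
  show ?thesis
    unfolding ax by (rule has_derivative_sum) (rule bounded_linear.has_derivative[OF lin assms])
qed

lemma has_derivative_cis: "(cis has_derivative (\<lambda>h. of_real h * (\<i> * cis x))) (at x)"
proof -
  have "((\<lambda>z. exp (\<i> * z)) has_field_derivative \<i> * exp (\<i> * of_real x)) (at (of_real x))"
    by (auto intro!: derivative_eq_intros)
  from has_vector_derivative_real_field[OF this] show ?thesis
    by (simp add: has_vector_derivative_def scaleR_conv_of_real flip: cis_conv_exp)
qed

lemma tangent_map_eq:
  "tangent_map \<alpha> \<gamma> \<phi> u = (\<chi> j. \<i> * of_real (SL_radius \<alpha> \<gamma>) * cis (\<phi> $ j) * of_real (u $ j))"
proof -
  have "(e0 \<alpha> \<gamma> has_derivative (\<lambda>h. \<chi> j. \<i> * of_real (SL_radius \<alpha> \<gamma>) * cis (\<phi> $ j) * of_real (h $ j))) (at \<phi>)"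
    unfolding e0_def
  proof (rule has_derivative_vec_lambda)
    fix j
    have "((\<lambda>\<phi>. \<phi> $ j) has_derivative (\<lambda>h. h $ j)) (at \<phi>)"
      by (rule bounded_linear_imp_has_derivative[OF bounded_linear_vec_nth])
    from has_derivative_mult_right[OF has_derivative_compose[OF this has_derivative_cis]]
    show "((\<lambda>\<phi>. of_real (SL_radius \<alpha> \<gamma>) * cis (\<phi> $ j)) has_derivative
        (\<lambda>h. \<i> * of_real (SL_radius \<alpha> \<gamma>) * cis (\<phi> $ j) * of_real (h $ j))) (at \<phi>)"
      by (rule has_derivative_eq_rhs) (simp add: fun_eq_iff)
  qed
  then show ?thesis unfolding tangent_map_def by (simp add: frechet_derivative_at[symmetric])
qed

text \<open>The component \<open>u\<close> of \<open>z = T(\<phi>)u + N(\<phi>)v\<close>, read off after rotating each \<open>z\<^sub>j\<close> by \<open>-\<phi>\<^sub>j\<close>.\<close>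

definition tangent_coord :: "real \<Rightarrow> real \<Rightarrow> real \<Rightarrow> real^2 \<Rightarrow> complex^2 \<Rightarrow> real^2" where
  "tangent_coord \<alpha> \<gamma> \<delta> \<phi> z =
     (\<chi> j. (Im (z $ j * cis (- \<phi> $ j)) - \<delta> / \<gamma> * Re (z $ j * cis (- \<phi> $ j))) / SL_radius \<alpha> \<gamma>)"

text \<open>In the rotated frame a tangent vector is purely imaginary, so only the \<open>Im\<close>
  term survives, and division by the radius recovers \<open>u\<close>.\<close>

lemma tangent_coord_tangent_map:
  assumes "\<alpha> * \<gamma> < 0"
  shows "tangent_coord \<alpha> \<gamma> \<delta> \<phi> (tangent_map \<alpha> \<gamma> \<phi> u) = u"
proof -
  have w: "tangent_map \<alpha> \<gamma> \<phi> u $ j * cis (- \<phi> $ j) = \<i> * of_real (SL_radius \<alpha> \<gamma> * u $ j)" for j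
  proof -
    have "tangent_map \<alpha> \<gamma> \<phi> u $ j * cis (- \<phi> $ j) =
        \<i> * of_real (SL_radius \<alpha> \<gamma> * u $ j) * (cis (\<phi> $ j) * cis (- \<phi> $ j))"
      by (simp only: tangent_map_eq vec_lambda_beta of_real_mult mult_ac)
    also have "cis (\<phi> $ j) * cis (- \<phi> $ j) = 1" by (simp add: cis_mult)
    finally show ?thesis by simp
  qed
  show ?thesis using SL_radius_pos[OF assms]
    unfolding tangent_coord_def w by (simp add: vec_eq_iff)
qed

text \<open>In the rotated frame a vanishing coordinate means
  \<open>Im = \<delta> / \<gamma> * Re\<close>, which is the real line spanned by
  \<open>Complex \<gamma> \<delta>\<close>.\<close>

lemma tangent_coord_kernel:
  assumes "\<alpha> * \<gamma> < 0"
  shows "{z. tangent_coord \<alpha> \<gamma> \<delta> \<phi> z = 0} = range (normal_map \<gamma> \<delta> \<phi>)"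
proof (intro equalityI subsetI)
  have g: "\<gamma> \<noteq> 0" using assms by auto
  note R = SL_radius_pos[OF assms]
  {
    fix z assume "z \<in> range (normal_map \<gamma> \<delta> \<phi>)"
    then obtain u where z: "z = normal_map \<gamma> \<delta> \<phi> u" by blast
    have w: "z $ j * cis (- \<phi> $ j) = Complex \<gamma> \<delta> * of_real (u $ j)" for j
    proof -
      have "z $ j * cis (- \<phi> $ j) = Complex \<gamma> \<delta> * of_real (u $ j) * (cis (\<phi> $ j) * cis (- \<phi> $ j))"
        unfolding z normal_map_def by (simp only: vec_lambda_beta mult_ac)
      also have "cis (\<phi> $ j) * cis (- \<phi> $ j) = 1" by (simp add: cis_mult)
      finally show ?thesis by simp
    qed
    show "z \<in> {z. tangent_coord \<alpha> \<gamma> \<delta> \<phi> z = 0}"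
      using g unfolding tangent_coord_def mem_Collect_eq w by (simp add: vec_eq_iff)
  next
    fix z assume "z \<in> {z. tangent_coord \<alpha> \<gamma> \<delta> \<phi> z = 0}"
    then have im: "Im (z $ j * cis (- \<phi> $ j)) = \<delta> / \<gamma> * Re (z $ j * cis (- \<phi> $ j))" for j
      using R unfolding tangent_coord_def mem_Collect_eq vec_eq_iff vec_lambda_beta zero_index
      by (metis less_irrefl divide_eq_0_iff eq_iff_diff_eq_0)
    \<comment> \<open>As \<gamma> is nonzero, a point of that line is determined by its real part,
      and this is its real multiple of \<open>Complex \<gamma> \<delta>\<close>.\<close>
    define u where "u = (\<chi> j. Re (z $ j * cis (- \<phi> $ j)) / \<gamma>)"
    have line: "x = Complex \<gamma> \<delta> * of_real (Re x / \<gamma>)" if "Im x = \<delta> / \<gamma> * Re x" for x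
      using g that by (simp add: complex_eq_iff)
    have "z $ j = Complex \<gamma> \<delta> * cis (\<phi> $ j) * of_real (u $ j)" for j
    proof -
      have "z $ j = z $ j * (cis (- \<phi> $ j) * cis (\<phi> $ j))" by (simp only: cis_mult) simp
      also have "\<dots> = (z $ j * cis (- \<phi> $ j)) * cis (\<phi> $ j)" by (simp only: mult.assoc)
      also have "z $ j * cis (- \<phi> $ j) = Complex \<gamma> \<delta> * of_real (u $ j)"
        using line[OF im[of j]] by (simp only: u_def vec_lambda_beta)
      finally show ?thesis by (simp only: mult_ac)
    qed
    then have "z = normal_map \<gamma> \<delta> \<phi> u"
      by (simp only: normal_map_def vec_eq_iff vec_lambda_beta) simp
    then show "z \<in> range (normal_map \<gamma> \<delta> \<phi>)" by blast
  }
qed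

lemma tangent_proj_eq:
  assumes "\<alpha> * \<gamma> < 0"
  shows "tangent_proj \<alpha> \<gamma> \<delta> \<phi> z = tangent_map \<alpha> \<gamma> \<phi> (tangent_coord \<alpha> \<gamma> \<delta> \<phi> z)"
proof -
  have "linear (tangent_map \<alpha> \<gamma> \<phi>)"
    by (intro linearI) (auto simp: tangent_map_eq vec_eq_iff scaleR_conv_of_real[where 'a=complex] ring_distribs)
  moreover have "linear (tangent_coord \<alpha> \<gamma> \<delta> \<phi>)"
    by (intro linearI) (simp_all add: tangent_coord_def vec_eq_iff ring_distribs mult.left_commute add_divide_distrib diff_divide_distrib)
  ultimately show ?thesis
    unfolding tangent_proj_def
    by (simp add: projection_along_eqI tangent_coord_tangent_map[OF assms] tangent_coord_kernel[OF assms])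
qed

text \<open>The parameter \<open>c\<close> stands for \<open>\<rho> - \<Omega>\<tau>\<close>.\<close>

definition phase_coupling :: "real \<Rightarrow> real \<Rightarrow> real \<Rightarrow> real \<Rightarrow> real^2 \<Rightarrow> real^2" where
  "phase_coupling \<gamma> \<delta> \<rho> c \<phi> =
     (\<chi> j. sin (c + \<phi> $ (j + 1) - \<phi> $ j) - sin \<rho>
          - \<delta> / \<gamma> * (cos (c + \<phi> $ (j + 1) - \<phi> $ j) - cos \<rho>))"

text \<open>Along the unperturbed orbit the delay is merely a phase lag, frequency times \<tau>,
  which joins \<rho>. The radius in the coupling cancels against the one in
  \<open>tangent_coord\<close>.\<close>

lemma tangent_coord_eta1:
  assumes "\<alpha> * \<gamma> < 0"
  shows "tangent_coord \<alpha> \<gamma> \<delta> \<phi> (eta1 \<alpha> \<beta> \<gamma> \<delta> \<rho> \<tau> \<phi>) =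
         phase_coupling \<gamma> \<delta> \<rho> (\<rho> - SL_freq \<alpha> \<beta> \<gamma> \<delta> * \<tau>) \<phi>"
proof -
  let ?R = "SL_radius \<alpha> \<gamma>" and ?c = "\<rho> - SL_freq \<alpha> \<beta> \<gamma> \<delta> * \<tau>"
  have w: "eta1 \<alpha> \<beta> \<gamma> \<delta> \<rho> \<tau> \<phi> $ j * cis (- \<phi> $ j) =
      of_real ?R * (cis (?c + \<phi> $ (j + 1) - \<phi> $ j) - cis \<rho>)" for j
  proof -
    have "eta1 \<alpha> \<beta> \<gamma> \<delta> \<rho> \<tau> \<phi> $ j * cis (- \<phi> $ j) =
        of_real ?R * (cis \<rho> * cis (\<phi> $ (j + 1) - SL_freq \<alpha> \<beta> \<gamma> \<delta> * \<tau>) * cis (- \<phi> $ j)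
          - cis \<rho> * (cis (\<phi> $ j) * cis (- \<phi> $ j)))"
      by (simp add: eta1_def SL_coupling_def E0_def algebra_simps)
    also have "\<dots> = of_real ?R * (cis (?c + \<phi> $ (j + 1) - \<phi> $ j) - cis \<rho>)"
      by (simp add: cis_mult algebra_simps)
    finally show ?thesis .
  qed
  show ?thesis using SL_radius_pos[OF assms]
    unfolding tangent_coord_def phase_coupling_def w by (simp add: vec_eq_iff field_simps)
qed

lemma torus_periodic_phase_coupling: "torus_periodic (phase_coupling \<gamma> \<delta> \<rho> c)"
proof -
  have s: "sin (x + 2 * pi - y) = sin (x - y)" "cos (x + 2 * pi - y) = cos (x - y)"
    "sin (x - (y + 2 * pi)) = sin (x - y)" "cos (x - (y + 2 * pi)) = cos (x - y)"
    "sin (x + (z + 2 * pi) - y) = sin (x + z - y)" "cos (x + (z + 2 * pi) - y) = cos (x + z - y)" for x y z :: real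
    using sin_periodic[of "x - y"] cos_periodic[of "x - y"] sin_periodic[of "x - y - 2 * pi"]
      cos_periodic[of "x - y - 2 * pi"] sin_periodic[of "x + z - y"] cos_periodic[of "x + z - y"]
    by (simp_all add: algebra_simps)
  show ?thesis
    unfolding torus_periodic_def phase_coupling_def
    by (simp add: forall_2 vec_eq_iff axis_def s)
qed

lemma continuous_on_phase_coupling: "continuous_on S (phase_coupling \<gamma> \<delta> \<rho> c)"
  unfolding phase_coupling_def by (intro continuous_intros)

lemma phase_coupling_diagonal: "phase_coupling \<gamma> \<delta> \<rho> c (\<phi> + vec t) = phase_coupling \<gamma> \<delta> \<rho> c \<phi>"
  by (simp add: phase_coupling_def algebra_simps)

text \<open>The terms in \<rho> cancel. The arguments that remain are \<open>c\<close> minus and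
  plus the phase difference, so the addition theorems leave a multiple of its sine.\<close>

lemma phase_coupling_diff:
  "phase_coupling \<gamma> \<delta> \<rho> c \<phi> $ 1 - phase_coupling \<gamma> \<delta> \<rho> c \<phi> $ 2 =
   - 2 * (cos c + \<delta> / \<gamma> * sin c) * sin (\<phi> $ 1 - \<phi> $ 2)"
proof -
  \<comment> \<open>Index arithmetic is modulo two, so adding one swaps the oscillators.\<close>
  have "(2::2) + 1 = 1" "(1::2) + 1 = 2" using exhaust_2[of "2 + 1"] by auto
  moreover have "c + \<phi> $ 2 - \<phi> $ 1 = c - (\<phi> $ 1 - \<phi> $ 2)" "c + \<phi> $ 1 - \<phi> $ 2 = c + (\<phi> $ 1 - \<phi> $ 2)" by simp_all
  ultimately show ?thesis
    unfolding phase_coupling_def vec_lambda_beta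
    by (simp only:) (simp add: sin_add sin_diff cos_add cos_diff algebra_simps)
qed

section \<open>Solving the first-order equation\<close>

lemma torus_periodic_nth: "torus_periodic h \<Longrightarrow> torus_periodic (\<lambda>\<phi>. h \<phi> $ j)"
  by (simp add: torus_periodic_def)

text \<open>Existence and uniqueness in one: the projected coupling \<open>h\<close> is already in
  normal form, so nothing is left for \<open>g\<close> to absorb, and any other solution is compared
  with \<open>(0, h)\<close>.\<close>

lemma first_order_solution_iff:
  assumes "\<alpha> * \<gamma> < 0" and freq: "SL_freq \<alpha> \<beta> \<gamma> \<delta> \<noteq> 0"
  shows "first_order_solution \<alpha> \<beta> \<gamma> \<delta> \<rho> \<tau> g f \<longleftrightarrow>
         g = (\<lambda>_. 0) \<and> f = phase_coupling \<gamma> \<delta> \<rho> (\<rho> - SL_freq \<alpha> \<beta> \<gamma> \<delta> * \<tau>)"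
proof -
  define w where "w = SL_freq \<alpha> \<beta> \<gamma> \<delta>"
  define h where "h = phase_coupling \<gamma> \<delta> \<rho> (\<rho> - w * \<tau>)"
  have w: "w \<noteq> 0" using freq by (simp add: w_def)
  have fv: "freq_vec \<alpha> \<beta> \<gamma> \<delta> = w *\<^sub>R vec 1"
    by (simp add: freq_vec_def vec_eq_iff w_def)
  \<comment> \<open>Both frequencies equal the nonzero \<open>w\<close>, so resonance is a condition
    on \<open>k\<close> alone.\<close>
  have res: "pairing k (freq_vec \<alpha> \<beta> \<gamma> \<delta>) = 0 \<longleftrightarrow> k $ 1 + k $ 2 = 0" for k
  proof -
    have "freq_vec \<alpha> \<beta> \<gamma> \<delta> = vec w" by (simp add: fv vec_eq_iff)
    then show ?thesis using w by (simp add: pairing_vec flip: of_int_add)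
  qed
  \<comment> \<open>\<open>tangent_coord\<close> is a left inverse of the tangent map, so the latter
    is injective and the equation can be read in coordinates.\<close>
  have eqn: "tangent_map \<alpha> \<gamma> \<phi> x = tangent_proj \<alpha> \<gamma> \<delta> \<phi> (eta1 \<alpha> \<beta> \<gamma> \<delta> \<rho> \<tau> \<phi>) \<longleftrightarrow> x = h \<phi>" for \<phi> x
    unfolding tangent_proj_eq[OF assms(1)] tangent_coord_eta1[OF assms(1)] h_def w_def
    by (metis tangent_coord_tangent_map[OF assms(1)])
  have coeff: "fourier_coeff u k = 0 \<longleftrightarrow> (\<forall>j. fourier_int (\<lambda>\<phi>. u \<phi> $ j) k = 0)" for u k
    by (simp add: vec_eq_iff fourier_coeff_nth)
  have h: "torus_periodic h" "continuous_on UNIV h" "\<And>\<phi> t. h (\<phi> + vec t) = h \<phi>"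
    unfolding h_def by (rule torus_periodic_phase_coupling continuous_on_phase_coupling phase_coupling_diagonal)+
  have h_res: "fourier_int (\<lambda>\<phi>. h \<phi> $ j) k = 0" if "k $ 1 + k $ 2 \<noteq> 0" for j k
    using that h by (intro diagonal_invariant_fourier_int_zero torus_periodic_nth) (auto intro!: continuous_intros)
  note unf = first_order_solution_def eqn res coeff
  have "first_order_solution \<alpha> \<beta> \<gamma> \<delta> \<rho> \<tau> (\<lambda>_. 0) h"
    unfolding unf using h h_res by (simp add: torus_periodic_def frechet_derivative_const fourier_int_def)
  moreover have "g = (\<lambda>_. 0) \<and> f = h" if "first_order_solution \<alpha> \<beta> \<gamma> \<delta> \<rho> \<tau> g f"
  proof -
    have per: "torus_periodic g" "torus_periodic f" and diff: "g differentiable_on UNIV"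
      and cont: "continuous_on UNIV f"
      and eq: "\<And>\<phi>. frechet_derivative g (at \<phi>) (freq_vec \<alpha> \<beta> \<gamma> \<delta>) + f \<phi> = h \<phi>"
      and f_res: "\<And>k j. k $ 1 + k $ 2 \<noteq> 0 \<Longrightarrow> fourier_int (\<lambda>\<phi>. f \<phi> $ j) k = 0"
      and g_res: "\<And>k j. k $ 1 + k $ 2 = 0 \<Longrightarrow> fourier_int (\<lambda>\<phi>. g \<phi> $ j) k = 0"
      using that unfolding unf by auto
    have D: "(g has_derivative frechet_derivative g (at \<phi>)) (at \<phi>)" for \<phi>
      using diff frechet_derivative_works by (auto simp: differentiable_on_def)
    \<comment> \<open>Division by \<open>w\<close> passes from the flow with the frequency vector to
      the unit-speed diagonal flow.\<close>
    have D1: "frechet_derivative g (at \<phi>) (vec 1) = (h \<phi> - f \<phi>) /\<^sub>R w" for \<phi>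
    proof -
      have "w *\<^sub>R frechet_derivative g (at \<phi>) (vec 1) = h \<phi> - f \<phi>"
        using eq[of \<phi>] by (simp add: fv linear_scale[OF has_derivative_linear[OF D]] eq_diff_eq)
      then show ?thesis using w by (metis scaleR_left_imp_eq scaleR_scaleR right_inverse scaleR_one)
    qed
    have line: "((\<lambda>s. g (\<phi> + vec s)) has_vector_derivative (h (\<phi> + vec t) - f (\<phi> + vec t)) /\<^sub>R w) (at t)" for \<phi> t
    proof -
      have v: "vec s = s *\<^sub>R (vec 1 :: real^2)" for s by (simp add: vec_eq_iff)
      have "((\<lambda>s. \<phi> + s *\<^sub>R vec 1) has_vector_derivative vec 1) (at t)"
        by (auto intro!: derivative_eq_intros)
      then have "((g \<circ> (\<lambda>s. \<phi> + s *\<^sub>R vec 1)) has_vector_derivative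
          frechet_derivative g (at (\<phi> + t *\<^sub>R vec 1)) (vec 1)) (at t)"
        by (rule vector_derivative_diff_chain_within[OF _ has_derivative_at_withinI[OF D]])
      then show ?thesis unfolding D1 v[symmetric] comp_def .
    qed
    have "(h \<phi> $ j - f \<phi> $ j) / w = 0 \<and> g \<phi> $ j = 0" for \<phi> j
    proof -
      \<comment> \<open>\<open>?F\<close> is the derivative of \<open>?G\<close> along the diagonal;
        it has resonant modes only, since both \<open>h\<close> and \<open>f\<close> do.\<close>
      let ?F = "\<lambda>\<phi>. (h \<phi> $ j - f \<phi> $ j) / w" and ?G = "\<lambda>\<phi>. g \<phi> $ j"
      have "torus_periodic ?F" using per h by (simp add: torus_periodic_def)
      moreover have "continuous_on UNIV ?F" using w by (intro continuous_intros h cont) auto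
      moreover have "continuous_on UNIV ?G"
        by (intro continuous_intros differentiable_imp_continuous_on diff)
      moreover have "((\<lambda>s. ?G (\<phi> + vec s)) has_real_derivative ?F (\<phi> + vec t)) (at t)" for \<phi> t
        using bounded_linear.has_vector_derivative[OF bounded_linear_vec_nth[of j] line[of \<phi> t]]
        by (simp add: has_real_derivative_iff_has_vector_derivative divide_inverse mult.commute)
      moreover have "fourier_int ?F k = 0" if "k $ 1 + k $ 2 \<noteq> 0" for k
        using fourier_int_cmult[of "\<lambda>\<phi>. h \<phi> $ j - f \<phi> $ j" "1 / w" k] that h cont
        by (simp add: fourier_int_diff h_res f_res continuous_intros)
      ultimately show ?thesis
        using diagonal_transport_zero[of ?F ?G \<phi>] torus_periodic_nth[OF per(1)] g_res by blast
    qed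
    then show ?thesis using w by (auto simp: fun_eq_iff vec_eq_iff)
  qed
  ultimately show ?thesis unfolding h_def w_def by blast
qed

lemma f1_eq:
  assumes "\<alpha> * \<gamma> < 0" and "SL_freq \<alpha> \<beta> \<gamma> \<delta> \<noteq> 0"
  shows "f1 \<alpha> \<beta> \<gamma> \<delta> \<rho> \<tau> = phase_coupling \<gamma> \<delta> \<rho> (\<rho> - SL_freq \<alpha> \<beta> \<gamma> \<delta> * \<tau>)"
proof -
  have "(THE p. first_order_solution \<alpha> \<beta> \<gamma> \<delta> \<rho> \<tau> (fst p) (snd p)) =
      (\<lambda>_. 0, phase_coupling \<gamma> \<delta> \<rho> (\<rho> - SL_freq \<alpha> \<beta> \<gamma> \<delta> * \<tau>))"
    by (rule the_equality) (auto simp: first_order_solution_iff[OF assms] prod_eq_iff)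
  then show ?thesis by (simp add: f1_def)
qed

section \<open>The periodic orbits of the uncoupled oscillators\<close>

lemma delay_SL_solution_orbit:
  assumes "\<alpha> * \<gamma> < 0"
  shows "delay_SL_solution \<alpha> \<beta> \<gamma> \<delta> \<rho> \<tau> 0 (\<lambda>t. \<chi> j. SL_orbit \<alpha> \<beta> \<gamma> \<delta> t)"
  unfolding delay_SL_solution_def
proof
  fix t
  let ?R = "SL_radius \<alpha> \<gamma>" and ?w = "SL_freq \<alpha> \<beta> \<gamma> \<delta>"
  have g: "\<gamma> \<noteq> 0" using assms by auto
  have "((\<lambda>t. ?w * t) has_derivative (\<lambda>h. ?w * h)) (at t)"
    by (auto intro!: derivative_eq_intros)
  from has_derivative_mult_right[OF has_derivative_compose[OF this has_derivative_cis], of "of_real ?R"]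
  have "(SL_orbit \<alpha> \<beta> \<gamma> \<delta> has_derivative (\<lambda>h. of_real h * (\<i> * ?w * SL_orbit \<alpha> \<beta> \<gamma> \<delta> t))) (at t)"
    unfolding SL_orbit_def[abs_def]
    by (rule has_derivative_eq_rhs) (simp only: of_real_mult mult_ac)
  then have "((\<lambda>t. \<chi> j::2. SL_orbit \<alpha> \<beta> \<gamma> \<delta> t) has_derivative
      (\<lambda>h. \<chi> j. of_real h * (\<i> * ?w * SL_orbit \<alpha> \<beta> \<gamma> \<delta> t))) (at t)"
    by (rule has_derivative_vec_lambda)
  moreover have "(\<lambda>h. \<chi> j::2. of_real h * (\<i> * ?w * SL_orbit \<alpha> \<beta> \<gamma> \<delta> t)) =
      (\<lambda>h. h *\<^sub>R SL_field \<alpha> \<beta> \<gamma> \<delta> (\<chi> j. SL_orbit \<alpha> \<beta> \<gamma> \<delta> t))"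
  proof -
    have "(of_real (cmod (SL_orbit \<alpha> \<beta> \<gamma> \<delta> t)))\<^sup>2 = complex_of_real (- \<alpha> / \<gamma>)"
      using SL_radius_sq[OF assms] SL_radius_pos[OF assms]
      by (simp add: SL_orbit_def norm_mult flip: of_real_power)
    \<comment> \<open>The squared radius is exactly the value that cancels the real part, and the
      imaginary part left over is the frequency.\<close>
    moreover have "Complex \<alpha> \<beta> + Complex \<gamma> \<delta> * complex_of_real (- \<alpha> / \<gamma>) = \<i> * ?w"
      using g by (simp add: complex_eq_iff SL_freq_def mult.commute)
    ultimately have "Complex \<alpha> \<beta> * SL_orbit \<alpha> \<beta> \<gamma> \<delta> t +
        Complex \<gamma> \<delta> * (of_real (cmod (SL_orbit \<alpha> \<beta> \<gamma> \<delta> t)))\<^sup>2 * SL_orbit \<alpha> \<beta> \<gamma> \<delta> t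
        = \<i> * ?w * SL_orbit \<alpha> \<beta> \<gamma> \<delta> t"
      by (metis distrib_right)
    then show ?thesis by (simp add: SL_field_def fun_eq_iff vec_eq_iff scaleR_conv_of_real[where 'a=complex])
  qed
  ultimately show "((\<lambda>t. \<chi> j. SL_orbit \<alpha> \<beta> \<gamma> \<delta> t) has_vector_derivative
      SL_field \<alpha> \<beta> \<gamma> \<delta> (\<chi> j. SL_orbit \<alpha> \<beta> \<gamma> \<delta> t) +
      0 *\<^sub>R SL_coupling \<rho> \<tau> (\<lambda>s. \<chi> j. SL_orbit \<alpha> \<beta> \<gamma> \<delta> (t + s))) (at t)"
    by (simp add: has_vector_derivative_def)
qed

lemma nonconstant_periodic_orbit:
  assumes "\<alpha> * \<gamma> < 0" and "SL_freq \<alpha> \<beta> \<gamma> \<delta> \<noteq> 0"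
  shows "nonconstant_periodic (SL_orbit \<alpha> \<beta> \<gamma> \<delta>)"
  unfolding nonconstant_periodic_def
proof
  let ?w = "SL_freq \<alpha> \<beta> \<gamma> \<delta>"
  have "SL_orbit \<alpha> \<beta> \<gamma> \<delta> (t + 2 * pi / \<bar>?w\<bar>) = SL_orbit \<alpha> \<beta> \<gamma> \<delta> t" for t
  proof -
    \<comment> \<open>The frequency may be negative; the absolute value keeps the period positive,
      and the phase then moves by a full turn in either direction.\<close>
    have "?w * (t + 2 * pi / \<bar>?w\<bar>) = ?w * t + 2 * pi \<or> ?w * (t + 2 * pi / \<bar>?w\<bar>) = ?w * t - 2 * pi"
      using assms(2) by (auto simp: abs_if field_simps)
    then show ?thesis
      by (auto simp: SL_orbit_def cis_mult[symmetric] cis_divide[symmetric])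
  qed
  moreover have "2 * pi / \<bar>?w\<bar> > 0" using assms by simp
  ultimately show "\<exists>P>0. \<forall>t. SL_orbit \<alpha> \<beta> \<gamma> \<delta> (t + P) = SL_orbit \<alpha> \<beta> \<gamma> \<delta> t" by blast
  \<comment> \<open>At phase \<pi> the orbit is at the opposite point, which differs because the
    radius is positive.\<close>
  have "SL_orbit \<alpha> \<beta> \<gamma> \<delta> 0 \<noteq> SL_orbit \<alpha> \<beta> \<gamma> \<delta> (pi / ?w)"
    using SL_radius_pos[OF assms(1)] assms(2) by (simp add: SL_orbit_def)
  then show "\<exists>s t. SL_orbit \<alpha> \<beta> \<gamma> \<delta> s \<noteq> SL_orbit \<alpha> \<beta> \<gamma> \<delta> t" by blast
qed

text \<open>The conjuncts before the phase equation secure its ingredients: the orbit really is a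
  periodic solution without coupling, and the definite description behind \<open>f1\<close>
  denotes.\<close>

theorem lemma3p1:
  fixes \<alpha> \<beta> \<gamma> \<delta> \<rho> \<tau> :: real
  assumes "\<alpha> * \<gamma> < 0" and "SL_freq \<alpha> \<beta> \<gamma> \<delta> \<noteq> 0" and "0 \<le> \<rho>" and "\<rho> \<le> 2 * pi" and "0 < \<tau>"
  shows "delay_SL_solution \<alpha> \<beta> \<gamma> \<delta> \<rho> \<tau> 0 (\<lambda>t. \<chi> j. SL_orbit \<alpha> \<beta> \<gamma> \<delta> t)
    \<and> nonconstant_periodic (SL_orbit \<alpha> \<beta> \<gamma> \<delta>)
    \<and> (\<exists>!p. first_order_solution \<alpha> \<beta> \<gamma> \<delta> \<rho> \<tau> (fst p) (snd p))
    \<and> (\<forall>\<epsilon> \<phi> I. 0 \<le> \<epsilon> \<longrightarrow> is_interval I \<longrightarrow> phase_trajectory \<alpha> \<beta> \<gamma> \<delta> \<rho> \<tau> \<epsilon> I \<phi> \<longrightarrow>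
         (let \<psi> = \<lambda>t. \<phi> t $ 1 - \<phi> t $ 2 in
          \<forall>t\<in>I. (\<psi> has_real_derivative
            - 2 * \<epsilon> * (cos (\<rho> - SL_freq \<alpha> \<beta> \<gamma> \<delta> * \<tau>)
                        + \<delta> / \<gamma> * sin (\<rho> - SL_freq \<alpha> \<beta> \<gamma> \<delta> * \<tau>)) * sin (\<psi> t)) (at t within I)))"
proof (intro conjI allI impI)
  show "\<exists>!p. first_order_solution \<alpha> \<beta> \<gamma> \<delta> \<rho> \<tau> (fst p) (snd p)"
    unfolding first_order_solution_iff[OF assms(1,2)] by (metis fst_conv snd_conv prod_eqI)
next
  fix \<epsilon> \<phi> and I :: "real set"
  assume "phase_trajectory \<alpha> \<beta> \<gamma> \<delta> \<rho> \<tau> \<epsilon> I \<phi>"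
  let ?c = "\<rho> - SL_freq \<alpha> \<beta> \<gamma> \<delta> * \<tau>"
  let ?v = "\<lambda>t. f0 \<alpha> \<beta> \<gamma> \<delta> (\<phi> t) + \<epsilon> *\<^sub>R phase_coupling \<gamma> \<delta> \<rho> ?c (\<phi> t)"
  have "((\<lambda>t. \<phi> t $ 1 - \<phi> t $ 2) has_real_derivative
      - 2 * \<epsilon> * (cos ?c + \<delta> / \<gamma> * sin ?c) * sin (\<phi> t $ 1 - \<phi> t $ 2)) (at t within I)" if "t \<in> I" for t
  proof -
    have "(\<phi> has_vector_derivative ?v t) (at t within I)"
      using \<open>phase_trajectory \<alpha> \<beta> \<gamma> \<delta> \<rho> \<tau> \<epsilon> I \<phi>\<close> that
      by (simp add: phase_trajectory_def f1_eq[OF assms(1,2)])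
    then have "((\<lambda>t. \<phi> t $ 1 - \<phi> t $ 2) has_vector_derivative ?v t $ 1 - ?v t $ 2) (at t within I)"
      by (intro has_vector_derivative_diff bounded_linear.has_vector_derivative[OF bounded_linear_vec_nth])
    moreover have "?v t $ 1 - ?v t $ 2 = - 2 * \<epsilon> * (cos ?c + \<delta> / \<gamma> * sin ?c) * sin (\<phi> t $ 1 - \<phi> t $ 2)"
    proof -
      \<comment> \<open>The common frequency in \<open>f0\<close> drops out of the difference,
        leaving only the coupling terms.\<close>
      have "?v t $ 1 - ?v t $ 2 = \<epsilon> * (phase_coupling \<gamma> \<delta> \<rho> ?c (\<phi> t) $ 1 - phase_coupling \<gamma> \<delta> \<rho> ?c (\<phi> t) $ 2)"
        by (simp add: f0_def freq_vec_def right_diff_distrib)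
      then show ?thesis by (simp only: phase_coupling_diff mult_ac)
    qed
    ultimately show ?thesis
      by (simp only: has_real_derivative_iff_has_vector_derivative)
  qed
  then show "let \<psi> = \<lambda>t. \<phi> t $ 1 - \<phi> t $ 2 in
      \<forall>t\<in>I. (\<psi> has_real_derivative - 2 * \<epsilon> * (cos ?c + \<delta> / \<gamma> * sin ?c) * sin (\<psi> t)) (at t within I)"
    by (simp add: Let_def)
qed (rule delay_SL_solution_orbit[OF assms(1)] nonconstant_periodic_orbit[OF assms(1,2)])+

end
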